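(* Let $\mathcal{G}$ be an arbitrary graph, let $p\in[1,\infty)$, and let $f\in C^0(\mathcal{G},\mathbb{R})$ be such that $\delta f\in C^1_{(p)}(\mathcal{G},\mathbb{R})$. Then for each $\varepsilon>0$ there exists $g\in C^0_{(\infty)}(\mathcal{G},\mathbb{R})$ such that $\|\delta f-\delta g\|_p<\varepsilon$. In particular, $\delta g\in C^1_{(p)}(\mathcal{G},\mathbb{R})$. The same result holds with $\mathbb{R}$ replaced by $\mathbb{C}$.
   Context: For a graph $\mathcal{G}$ with vertex set $\Sigma_0$ and edge set $\Sigma_1$ (each edge given a fixed orientation), $C^i(\mathcal{G},\mathbb{R})$ is the set of all real $i$-cochains, i.e. all functions $\Sigma_i\to\mathbb{R}$, with no assumption on support ($i=0,1$). For $1\le p\le\infty$, $C^i_{(p)}(\mathcal{G},\mathbb{R})$ is the set of elements of $C^i(\mathcal{G},\mathbb{R})$ with finite $\ell^p$ norm $\|\cdot\|_p$. The coboundary map $\delta:C^0(\mathcal{G},\mathbb{R})\to C^1(\mathcal{G},\mathbb{R})$ assigns to $f$ the function whose value on an oriented edge is the value of $f$ at its terminal vertex minus the value of $f$ at its initial vertex. The complex versions $C^i(\mathcal{G},\mathbb{C})$, $C^i_{(p)}(\mathcal{G},\mathbb{C})$ are defined in the same way. *)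

theory Defs
  imports "HOL-Analysis.Analysis" "Graph_Theory.Digraph"
begin

text \<open>
  A graph whose edges carry a fixed orientation is a \<^locale>\<open>wf_digraph\<close> \<open>G\<close>: every element of
  \<open>arcs G\<close> is one edge, oriented from \<open>tail G e\<close> to \<open>head G e\<close>.  The graph may be infinite and
  need not be locally finite or connected; loops and multiple edges are allowed.

  A cochain is represented by a function that is \<^const>\<open>undefined\<close> outside the vertex (edge) set,
  so that \<open>cochains0 G\<close> and \<open>cochains1 G\<close> are in bijection with the functions on that set.
\<close>

definition cochains0 :: "('v, 'e) pre_digraph \<Rightarrow> ('v \<Rightarrow> 'k) set" where
  "cochains0 G = (verts G \<rightarrow>\<^sub>E UNIV)"

definition cochains1 :: "('v, 'e) pre_digraph \<Rightarrow> ('e \<Rightarrow> 'k) set" where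
  "cochains1 G = (arcs G \<rightarrow>\<^sub>E UNIV)"

text \<open>
  The norm takes values in the extended nonnegative reals and is \<open>\<infinity>\<close> when the sum diverges; the
  case distinction is needed because \<^const>\<open>infsum\<close> is \<open>0\<close> for non-summable families.  Only the
  values of \<open>c\<close> on \<open>A\<close> matter.  It is meant for \<open>1 \<le> p\<close>.
\<close>

definition lp_norm :: "ereal \<Rightarrow> 'a set \<Rightarrow> ('a \<Rightarrow> 'k::real_normed_vector) \<Rightarrow> ennreal" where
  "lp_norm p A c =
     (if p = \<infinity> then (SUP x\<in>A. ennreal (norm (c x)))
      else if (\<lambda>x. norm (c x) powr real_of_ereal p) summable_on A
      then ennreal ((\<Sum>\<^sub>\<infinity>x\<in>A. norm (c x) powr real_of_ereal p) powr (1 / real_of_ereal p))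
      else \<infinity>)"

definition lp_cochains0 ::
    "ereal \<Rightarrow> ('v, 'e) pre_digraph \<Rightarrow> ('v \<Rightarrow> 'k::real_normed_vector) set" where
  "lp_cochains0 p G = {f \<in> cochains0 G. lp_norm p (verts G) f < \<infinity>}"

definition lp_cochains1 ::
    "ereal \<Rightarrow> ('v, 'e) pre_digraph \<Rightarrow> ('e \<Rightarrow> 'k::real_normed_vector) set" where
  "lp_cochains1 p G = {c \<in> cochains1 G. lp_norm p (arcs G) c < \<infinity>}"

definition coboundary :: "('v, 'e) pre_digraph \<Rightarrow> ('v \<Rightarrow> 'k::minus) \<Rightarrow> 'e \<Rightarrow> 'k" where
  "coboundary G f = (\<lambda>e\<in>arcs G. f (head G e) - f (tail G e))"

end

theory Submission
  imports Defs
begin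

text \<open>
  The approximation is truncation: \<open>g\<close> is \<open>f\<close> followed by the nearest-point projection onto the
  closed ball of a large radius \<open>R\<close> around \<open>0\<close>.  This projection does not increase distances, so
  \<open>\<parallel>\<delta>g e\<parallel> \<le> \<parallel>\<delta>f e\<parallel>\<close> and hence \<open>\<parallel>\<delta>f e - \<delta>g e\<parallel> \<le> 2 \<parallel>\<delta>f e\<parallel>\<close> on every edge \<open>e\<close>, while \<open>\<delta>f e = \<delta>g e\<close>
  as soon as \<open>f\<close> is bounded by \<open>R\<close> at both ends of \<open>e\<close>.  Since \<open>\<Sum>\<parallel>\<delta>f e\<parallel>\<^sup>p\<close> converges, all but a
  finite set \<open>F\<close> of edges contribute an arbitrarily small amount \<open>t\<close> to it.  The finitely many
  endpoints of the edges in \<open>F\<close> determine a sufficient \<open>R\<close>: then \<open>\<delta>f - \<delta>g\<close> is supported off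
  \<open>F\<close>, and \<open>\<parallel>\<delta>f - \<delta>g\<parallel>\<^sub>p\<close> is at most \<open>2 t\<^bsup>1/p\<^esup>\<close>.

  The projection exists in every Euclidean space, so the real and the complex case are two
  instances of one argument.
\<close>

lemma lp_norm_finite_iff_summable:
  "lp_norm (ereal p) A c < \<infinity> \<longleftrightarrow> (\<lambda>x. norm (c x) powr p) summable_on A"
  by (simp add: lp_norm_def)

lemma summable_on_small_tail:
  fixes u :: "'a \<Rightarrow> real"
  assumes "u summable_on A" and "0 < \<eta>"
  obtains F where "finite F" "F \<subseteq> A" "u summable_on (A - F)" "infsum u (A - F) < \<eta>"
proof -
  obtain F where F: "finite F" "F \<subseteq> A" "dist (sum u F) (infsum u A) \<le> \<eta> / 2"
    using infsum_finite_approximation[OF assms(1), of "\<eta> / 2"] assms(2) by auto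
  have "infsum u (A - F) = infsum u A - infsum u F"
    using F assms(1) by (intro infsum_Diff) auto
  also have "\<dots> < \<eta>"
    using F assms(2) unfolding infsum_finite[OF F(1)] dist_real_def by argo
  finally show thesis
    using that F summable_on_subset_banach[OF assms(1), of "A - F"] by auto
qed

text \<open>
  The quantitative form of dominated convergence behind the approximation: where \<open>d\<close> vanishes,
  the size of \<open>c\<close> does not matter, so a small tail of \<open>c\<close> off \<open>F\<close> controls all of \<open>d\<close>.
\<close>

lemma lp_norm_less_if_dominated_off:
  fixes c :: "'a \<Rightarrow> 'k::real_normed_vector" and d :: "'a \<Rightarrow> 'l::real_normed_vector"
  assumes "0 < p" and "0 < K" and "0 < \<epsilon>"
    and F: "F \<subseteq> A" "\<And>x. x \<in> F \<Longrightarrow> d x = 0"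
    and le: "\<And>x. x \<in> A - F \<Longrightarrow> norm (d x) \<le> K * norm (c x)"
    and sum: "(\<lambda>x. norm (c x) powr p) summable_on (A - F)"
    and tail: "(\<Sum>\<^sub>\<infinity>x\<in>A - F. norm (c x) powr p) < (\<epsilon> / K) powr p"
  shows "lp_norm (ereal p) A d < ennreal \<epsilon>"
proof -
  let ?u = "\<lambda>x. norm (c x) powr p" and ?v = "\<lambda>x. norm (d x) powr p"
  have le': "?v x \<le> K powr p * ?u x" if "x \<in> A - F" for x
    using le[OF that] assms(1,2) powr_mono2[of p "norm (d x)" "K * norm (c x)"]
    by (simp add: powr_mult)
  have Ku: "(\<lambda>x. K powr p * ?u x) summable_on (A - F)"
    by (rule summable_on_cmult_right[OF sum])
  have v: "?v summable_on (A - F)"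
    by (rule summable_on_comparison_test[OF Ku le']) auto
  have vA: "?v summable_on A"
    using v F by (subst summable_on_cong_neutral[where T = "A - F" and g = ?v]) auto
  have "infsum ?v A = infsum ?v (A - F)"
    using F by (intro infsum_cong_neutral) auto
  also have "\<dots> \<le> (\<Sum>\<^sub>\<infinity>x\<in>A - F. K powr p * ?u x)"
    by (rule infsum_mono[OF v Ku le'])
  also have "\<dots> = K powr p * infsum ?u (A - F)"
    by (rule infsum_cmult_right[OF sum])
  also have "\<dots> < K powr p * (\<epsilon> / K) powr p"
    using tail assms(2) by simp
  also have "\<dots> = \<epsilon> powr p"
    using assms(2,3) by (simp add: powr_divide)
  finally have lt: "infsum ?v A < \<epsilon> powr p" .
  have "infsum ?v A powr (1 / p) < (\<epsilon> powr p) powr (1 / p)"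
    using lt assms(1) by (intro powr_less_mono2 infsum_nonneg) auto
  also have "\<dots> = \<epsilon>"
    using assms(1,3) by (simp add: powr_powr)
  finally show ?thesis
    using vA assms(3) by (simp add: lp_norm_def ennreal_lessI)
qed

lemma lp_norm_finite_if_dominated:
  assumes "0 < p" and "lp_norm (ereal p) A c < \<infinity>" and "\<And>x. x \<in> A \<Longrightarrow> norm (d x) \<le> norm (c x)"
  shows "lp_norm (ereal p) A d < \<infinity>"
  using assms unfolding lp_norm_finite_iff_summable
  by (elim summable_on_comparison_test) (auto intro: powr_mono2)

text \<open>
  Truncation at radius \<open>R\<close>: \<open>closest_point_lipschitz\<close> supplies the domination of \<open>\<delta>f - \<delta>g\<close> by
  \<open>2 \<parallel>\<delta>f\<parallel>\<close>, the choice of \<open>R\<close> its vanishing on \<open>F\<close>, and \<open>lp_norm_less_if_dominated_off\<close> turns the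
  two into the norm estimate.
\<close>

lemma exists_bounded_coboundary_approximation:
  fixes f :: "'v \<Rightarrow> 'k::euclidean_space" and G :: "('v, 'e) pre_digraph"
  assumes G: "wf_digraph G" and p: "0 < p"
    and \<delta>f: "coboundary G f \<in> lp_cochains1 (ereal p) G" and \<epsilon>: "0 < \<epsilon>"
  shows "\<exists>g :: 'v \<Rightarrow> 'k. g \<in> lp_cochains0 \<infinity> G \<and>
           lp_norm (ereal p) (arcs G) (\<lambda>e. coboundary G f e - coboundary G g e) < ennreal \<epsilon> \<and>
           coboundary G g \<in> lp_cochains1 (ereal p) G"
proof -
  interpret wf_digraph G by (fact G)
  have fin: "lp_norm (ereal p) (arcs G) (coboundary G f) < \<infinity>"
    using \<delta>f by (simp add: lp_cochains1_def)
  \<comment> \<open>The \<open>2\<close> is the constant in \<open>\<parallel>\<delta>f e - \<delta>g e\<parallel> \<le> 2 \<parallel>\<delta>f e\<parallel>\<close>.\<close>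
  obtain F where F: "finite F" "F \<subseteq> arcs G"
      "(\<lambda>e. norm (coboundary G f e) powr p) summable_on (arcs G - F)"
      "(\<Sum>\<^sub>\<infinity>e\<in>arcs G - F. norm (coboundary G f e) powr p) < (\<epsilon> / 2) powr p"
    using summable_on_small_tail[OF fin[unfolded lp_norm_finite_iff_summable],
        of "(\<epsilon> / 2) powr p"] \<epsilon> by auto
  have "bounded (f ` (head G ` F \<union> tail G ` F))"
    using F(1) by (intro finite_imp_bounded) auto
  then obtain R where R: "0 < R" "\<And>v. v \<in> head G ` F \<union> tail G ` F \<Longrightarrow> norm (f v) \<le> R"
    unfolding bounded_pos by blast
  define P where "P = closest_point (cball (0::'k) R)"
  define g where "g = (\<lambda>v\<in>verts G. P (f v))"
  have ball: "convex (cball (0::'k) R)" "closed (cball (0::'k) R)" "cball (0::'k) R \<noteq> {}"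
    using R(1) by auto
  have P_bound: "norm (P x) \<le> R" for x
    using closest_point_in_set[OF ball(2,3), of x] by (simp add: P_def)
  have P_id: "P x = x" if "norm x \<le> R" for x
    using that by (simp add: P_def closest_point_self)
  have \<delta>g: "coboundary G g e = P (f (head G e)) - P (f (tail G e))" if "e \<in> arcs G" for e
    using that by (simp add: coboundary_def g_def)
  have \<delta>g_le: "norm (coboundary G g e) \<le> norm (coboundary G f e)" if "e \<in> arcs G" for e
    using closest_point_lipschitz[OF ball, of "f (head G e)" "f (tail G e)"] that
    by (simp add: \<delta>g) (simp add: P_def coboundary_def dist_norm)
  have "lp_norm \<infinity> (verts G) g \<le> ennreal R"
    using P_bound by (auto simp: lp_norm_def g_def intro!: SUP_least ennreal_leI)
  then have g: "g \<in> lp_cochains0 \<infinity> G"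
    by (auto simp: lp_cochains0_def cochains0_def g_def intro: le_less_trans)
  have \<delta>g_lp: "coboundary G g \<in> lp_cochains1 (ereal p) G"
    using lp_norm_finite_if_dominated[OF p fin \<delta>g_le]
    by (auto simp: lp_cochains1_def cochains1_def) (simp add: coboundary_def)
  have "lp_norm (ereal p) (arcs G) (\<lambda>e. coboundary G f e - coboundary G g e) < ennreal \<epsilon>"
  proof (rule lp_norm_less_if_dominated_off[OF p _ \<epsilon> F(2) _ _ F(3,4)])
    show "coboundary G f e - coboundary G g e = 0" if "e \<in> F" for e
    proof -
      have "P (f (head G e)) = f (head G e)" "P (f (tail G e)) = f (tail G e)"
        using that R(2) by (auto intro!: P_id)
      moreover have "e \<in> arcs G"
        using that F(2) by auto
      ultimately show ?thesis
        by (simp add: \<delta>g) (simp add: coboundary_def)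
    qed
    show "norm (coboundary G f e - coboundary G g e) \<le> 2 * norm (coboundary G f e)"
      if "e \<in> arcs G - F" for e
      using norm_triangle_ineq4[of "coboundary G f e" "coboundary G g e"] \<delta>g_le[of e] that
      by simp
  qed simp
  with g \<delta>g_lp show ?thesis by blast
qed

theorem theorem2p1:
  fixes G :: "('v, 'e) pre_digraph" and p :: real
  assumes "wf_digraph G" and "1 \<le> p"
  shows "(\<forall>f :: 'v \<Rightarrow> real. f \<in> cochains0 G \<longrightarrow> coboundary G f \<in> lp_cochains1 (ereal p) G \<longrightarrow>
           (\<forall>\<epsilon>::real. \<epsilon> > 0 \<longrightarrow>
             (\<exists>g :: 'v \<Rightarrow> real. g \<in> lp_cochains0 \<infinity> G \<and>
               lp_norm (ereal p) (arcs G) (\<lambda>e. coboundary G f e - coboundary G g e) < ennreal \<epsilon> \<and>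
               coboundary G g \<in> lp_cochains1 (ereal p) G)))
       \<and> (\<forall>f :: 'v \<Rightarrow> complex. f \<in> cochains0 G \<longrightarrow> coboundary G f \<in> lp_cochains1 (ereal p) G \<longrightarrow>
           (\<forall>\<epsilon>::real. \<epsilon> > 0 \<longrightarrow>
             (\<exists>g :: 'v \<Rightarrow> complex. g \<in> lp_cochains0 \<infinity> G \<and>
               lp_norm (ereal p) (arcs G) (\<lambda>e. coboundary G f e - coboundary G g e) < ennreal \<epsilon> \<and>
               coboundary G g \<in> lp_cochains1 (ereal p) G)))"
  using assms
  by (intro conjI allI impI exists_bounded_coboundary_approximation) simp_all

end
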